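(* Let $I$ be a countable set, let $E$ be a quasi-normed ideal space over the counting measure space $(I,2^I,m)$, and let $\mathcal X=(X_\alpha)_{\alpha\in I}$ be a family of non-trivial quasi-normed lattices with moduli of concavity $C_\alpha$ satisfying $\sup_{\alpha\in I}C_\alpha<\infty$. Then the infinite direct sum $\mathcal E(\mathcal X)=\left(\oplus_{\alpha\in I}X_\alpha\right)_E$ is order continuous if and only if $E$ is order continuous and $X_\alpha$ is order continuous for every $\alpha\in I$.
   Context: A quasi-norm on a real vector space $X$ satisfies $\|x\|=0$ iff $x=0$, $\|ax\|=|a|\|x\|$, and $\|x+y\|\le C(\|x\|+\|y\|)$ for some $C\ge1$; the smallest such $C$ is the modulus of concavity of $X$. A quasi-normed ideal space over a measure space $(\Omega,\Sigma,\mu)$ is a linear subspace $E$ of $L^0(\Omega,\Sigma,\mu)$ (classes of real measurable functions) with a quasi-norm such that (i) if $f\in L^0$, $g\in E$, $|f|\le|g|$ a.e., then $f\in E$ and $\|f\|_E\le\|g\|_E$; (ii) there is $f\in E$ strictly positive on the whole of $\Omega$. The infinite direct sum is $\left(\oplus_{\alpha\in I}X_\alpha\right)_E=\{f=(f_\alpha)_\alpha: f_\alpha\in X_\alpha \text{ for each }\alpha,\ (\|f_\alpha\|_{X_\alpha})_\alpha\in E\}$ with quasi-norm $\|f\|=\left\|(\|f_\alpha\|_{X_\alpha})_\alpha\right\|_E$ and coordinatewise order: $f\le g$ iff $f_\alpha\le g_\alpha$ in $X_\alpha$ for all $\alpha$. A quasi-normed lattice $F$ is order continuous if for each sequence $(f_n)$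 in $F$ with $f_n\ge f_{n+1}$ and $\inf_n f_n=0$ we have $\|f_n\|_F\to0$. *)

theory Defs
  imports "HOL-Analysis.Analysis" "HOL-Algebra.Algebraic_Closure_Type"
begin

section \<open>Quasi-normed lattices\<close>

text \<open>
  The spaces of a family may all be different, so vector lattices are records with explicit
  carriers. A real vector space is a module of HOL-Algebra over the ring of type \<open>real\<close>;
  the fields \<open>mult\<close> and \<open>one\<close> that a module record inherits from rings are never used.
\<close>

record 'a ordered_vs = "(real, 'a) module" +
  leq :: "'a \<Rightarrow> 'a \<Rightarrow> bool"

record 'a quasi_normed_vs = "'a ordered_vs" +
  qnorm :: "'a \<Rightarrow> real"

abbreviation real_field :: "real ring"
  where "real_field \<equiv> ring_of_type_algebra"

definition order_of :: "('a, 'm) ordered_vs_scheme \<Rightarrow> 'a gorder"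
  where "order_of V = \<lparr>carrier = carrier V, eq = (=), le = leq V\<rparr>"

locale vector_lattice =
  module real_field V + ord: lattice "order_of V" for V :: "('a, 'm) ordered_vs_scheme" +
  assumes add_mono: "\<lbrakk>x \<in> carrier V; y \<in> carrier V; z \<in> carrier V; leq V x y\<rbrakk>
      \<Longrightarrow> leq V (x \<oplus>\<^bsub>V\<^esub> z) (y \<oplus>\<^bsub>V\<^esub> z)"
    and smult_mono: "\<lbrakk>x \<in> carrier V; y \<in> carrier V; 0 \<le> a; leq V x y\<rbrakk>
      \<Longrightarrow> leq V (a \<odot>\<^bsub>V\<^esub> x) (a \<odot>\<^bsub>V\<^esub> y)"

definition absolute_value :: "('a, 'm) ordered_vs_scheme \<Rightarrow> 'a \<Rightarrow> 'a"
  where "absolute_value V x = x \<squnion>\<^bsub>order_of V\<^esub> (\<ominus>\<^bsub>V\<^esub> x)"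

definition concavity_constant :: "('a, 'm) quasi_normed_vs_scheme \<Rightarrow> real \<Rightarrow> bool"
  where "concavity_constant V C \<longleftrightarrow> 1 \<le> C \<and>
    (\<forall>x\<in>carrier V. \<forall>y\<in>carrier V. qnorm V (x \<oplus>\<^bsub>V\<^esub> y) \<le> C * (qnorm V x + qnorm V y))"

definition quasi_norm :: "('a, 'm) quasi_normed_vs_scheme \<Rightarrow> bool"
  where "quasi_norm V \<longleftrightarrow>
    (\<forall>x\<in>carrier V. qnorm V x = 0 \<longleftrightarrow> x = \<zero>\<^bsub>V\<^esub>) \<and>
    (\<forall>a. \<forall>x\<in>carrier V. qnorm V (a \<odot>\<^bsub>V\<^esub> x) = \<bar>a\<bar> * qnorm V x) \<and>
    (\<exists>C. concavity_constant V C)"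

definition modulus_of_concavity :: "('a, 'm) quasi_normed_vs_scheme \<Rightarrow> real"
  where "modulus_of_concavity V = (LEAST C. concavity_constant V C)"

locale quasi_normed_lattice =
  vector_lattice V for V :: "('a, 'm) quasi_normed_vs_scheme" +
  assumes quasi_norm: "quasi_norm V"
    and qnorm_mono: "\<lbrakk>x \<in> carrier V; y \<in> carrier V; leq V (absolute_value V x) (absolute_value V y)\<rbrakk>
      \<Longrightarrow> qnorm V x \<le> qnorm V y"

text \<open>\<open>greatest L i (Lower L A)\<close> states that the infimum of \<open>A\<close> in \<open>L\<close> exists and is \<open>i\<close>.\<close>

definition order_continuous :: "('a, 'm) quasi_normed_vs_scheme \<Rightarrow> bool"
  where "order_continuous V \<longleftrightarrow>
    (\<forall>f :: nat \<Rightarrow> 'a. range f \<subseteq> carrier V \<and> (\<forall>n. leq V (f (Suc n)) (f n)) \<and>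
        greatest (order_of V) \<zero>\<^bsub>V\<^esub> (Lower (order_of V) (range f))
      \<longrightarrow> (\<lambda>n. qnorm V (f n)) \<longlonglongrightarrow> 0)"


section \<open>Quasi-normed ideal spaces\<close>

definition ae_class :: "'a measure \<Rightarrow> ('a \<Rightarrow> real) \<Rightarrow> ('a \<Rightarrow> real) set"
  where "ae_class M f = {g \<in> borel_measurable M. AE x in M. g x = f x}"

definition L0 :: "'a measure \<Rightarrow> ('a \<Rightarrow> real) set ordered_vs"
  where "L0 M =
    \<lparr>carrier = ae_class M ` borel_measurable M,
     mult = undefined, one = undefined,
     zero = ae_class M (\<lambda>_. 0),
     add = (\<lambda>F G. \<Union>f\<in>F. \<Union>g\<in>G. ae_class M (\<lambda>x. f x + g x)),
     smult = (\<lambda>a F. \<Union>f\<in>F. ae_class M (\<lambda>x. a * f x)),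
     leq = (\<lambda>F G. \<exists>f\<in>F. \<exists>g\<in>G. AE x in M. f x \<le> g x)\<rparr>"

text \<open>A linear subspace \<open>E\<close> of \<open>L0 M\<close> with quasi-norm \<open>N\<close>, as a structure in its own right.\<close>

definition ideal_lattice ::
    "'a measure \<Rightarrow> ('a \<Rightarrow> real) set set \<Rightarrow> (('a \<Rightarrow> real) set \<Rightarrow> real)
      \<Rightarrow> ('a \<Rightarrow> real) set quasi_normed_vs"
  where "ideal_lattice M E N =
    \<lparr>carrier = E, mult = undefined, one = undefined,
     zero = \<zero>\<^bsub>L0 M\<^esub>, add = (\<oplus>\<^bsub>L0 M\<^esub>), smult = (\<odot>\<^bsub>L0 M\<^esub>), leq = leq (L0 M),
     qnorm = N\<rparr>"

definition quasi_normed_ideal_space ::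
    "'a measure \<Rightarrow> ('a \<Rightarrow> real) set set \<Rightarrow> (('a \<Rightarrow> real) set \<Rightarrow> real) \<Rightarrow> bool"
  where "quasi_normed_ideal_space M E N \<longleftrightarrow>
    submodule E real_field (L0 M) \<and>
    quasi_norm (ideal_lattice M E N) \<and>
    (\<forall>f\<in>borel_measurable M. \<forall>g\<in>borel_measurable M.
        ae_class M g \<in> E \<and> (AE x in M. \<bar>f x\<bar> \<le> \<bar>g x\<bar>)
        \<longrightarrow> ae_class M f \<in> E \<and> N (ae_class M f) \<le> N (ae_class M g)) \<and>
    (\<exists>f\<in>borel_measurable M. ae_class M f \<in> E \<and> (\<forall>x\<in>space M. 0 < f x))"


section \<open>Infinite direct sums\<close>

text \<open>
  Families are extensional functions on \<open>I\<close>, so that equality of families is coordinatewise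
  equality on \<open>I\<close>. For \<open>count_space I\<close> every function is measurable and two functions are
  identified by \<open>ae_class\<close> exactly when they agree on \<open>I\<close>.
\<close>

definition norm_class :: "'i set \<Rightarrow> ('i \<Rightarrow> 'a quasi_normed_vs) \<Rightarrow> ('i \<Rightarrow> 'a) \<Rightarrow> ('i \<Rightarrow> real) set"
  where "norm_class I \<X> f = ae_class (count_space I) (\<lambda>\<alpha>. qnorm (\<X> \<alpha>) (f \<alpha>))"

definition direct_sum ::
    "'i set \<Rightarrow> ('i \<Rightarrow> real) set set \<Rightarrow> (('i \<Rightarrow> real) set \<Rightarrow> real) \<Rightarrow> ('i \<Rightarrow> 'a quasi_normed_vs)
      \<Rightarrow> ('i \<Rightarrow> 'a) quasi_normed_vs"
  where "direct_sum I E N \<X> =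
    \<lparr>carrier = {f \<in> (\<Pi>\<^sub>E \<alpha>\<in>I. carrier (\<X> \<alpha>)). norm_class I \<X> f \<in> E},
     mult = undefined, one = undefined,
     zero = (\<lambda>\<alpha>\<in>I. \<zero>\<^bsub>\<X> \<alpha>\<^esub>),
     add = (\<lambda>f g. \<lambda>\<alpha>\<in>I. f \<alpha> \<oplus>\<^bsub>\<X> \<alpha>\<^esub> g \<alpha>),
     smult = (\<lambda>a f. \<lambda>\<alpha>\<in>I. a \<odot>\<^bsub>\<X> \<alpha>\<^esub> f \<alpha>),
     leq = (\<lambda>f g. \<forall>\<alpha>\<in>I. leq (\<X> \<alpha>) (f \<alpha>) (g \<alpha>)),
     qnorm = (\<lambda>f. N (norm_class I \<X> f))\<rparr>"

end

theory Submission
  imports Defs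
begin

text \<open>
  Infima in the direct sum and in \<open>E\<close> are computed coordinate by coordinate. In the direct sum,
  a lower bound in one summand can be extended by zero to all of \<open>I\<close>; in \<open>E\<close>, solidity and a
  strictly positive element provide the indicator of every point, so a sequence decreases to zero
  exactly if it does so pointwise as a sequence of reals. These are the lemmas
  \<open>sum_decreases_to_zero_iff\<close> and \<open>decreases_to_zero_iff\<close>.

  If \<open>E\<close> and all summands are order continuous and \<open>f\<^sub>n\<close> decreases to zero in the direct sum, then
  so does each coordinate; hence the coordinate norms decrease to zero pointwise, that is, in \<open>E\<close>,
  and order continuity of \<open>E\<close> makes the quasi-norm of \<open>f\<^sub>n\<close> tend to zero.

  Conversely, the direct sum contains a copy of each summand, with its quasi-norm rescaled, and
  a copy of the positive cone of \<open>E\<close>, formed by the multiples of one positive unit vector in each summand. Both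
  copies preserve sequences decreasing to zero. For the second one this amounts to the
  Archimedean property of a quasi-normed lattice, \<open>decreases_to_zero_smult\<close>.
\<close>

section \<open>Sequences decreasing to zero\<close>

definition decreases_to_zero :: "('a, 'm) ordered_vs_scheme \<Rightarrow> (nat \<Rightarrow> 'a) \<Rightarrow> bool"
  where "decreases_to_zero V f \<longleftrightarrow>
    (\<forall>n. f n \<in> carrier V) \<and> (\<forall>n. leq V (f (Suc n)) (f n)) \<and>
    \<zero>\<^bsub>V\<^esub> \<in> carrier V \<and> (\<forall>n. leq V \<zero>\<^bsub>V\<^esub> (f n)) \<and>
    (\<forall>l\<in>carrier V. (\<forall>n. leq V l (f n)) \<longrightarrow> leq V l \<zero>\<^bsub>V\<^esub>)"

lemma order_continuous_iff:
  "order_continuous V \<longleftrightarrow>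
    (\<forall>f. decreases_to_zero V f \<longrightarrow> (\<lambda>n. qnorm V (f n)) \<longlonglongrightarrow> 0)"
proof -
  have "range f \<subseteq> carrier V \<and> (\<forall>n. leq V (f (Suc n)) (f n)) \<and>
        greatest (order_of V) \<zero>\<^bsub>V\<^esub> (Lower (order_of V) (range f)) \<longleftrightarrow> decreases_to_zero V f" for f
    unfolding decreases_to_zero_def greatest_def Lower_def order_of_def
    by (auto simp: image_subset_iff)
  then show ?thesis
    unfolding order_continuous_def by auto
qed

section \<open>Quasi-normed lattices\<close>

lemma real_field_simps [simp]:
  "carrier real_field = UNIV" "\<zero>\<^bsub>real_field\<^esub> = 0" "\<one>\<^bsub>real_field\<^esub> = 1"
  "a \<oplus>\<^bsub>real_field\<^esub> b = a + b" "a \<otimes>\<^bsub>real_field\<^esub> b = a * b"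
  by (simp_all add: ring_of_type_algebra_def)

context vector_lattice
begin

lemma leq_refl: "x \<in> carrier V \<Longrightarrow> leq V x x"
  using ord.le_refl by (simp add: order_of_def)

lemma leq_trans:
  "\<lbrakk>leq V x y; leq V y z; x \<in> carrier V; y \<in> carrier V; z \<in> carrier V\<rbrakk> \<Longrightarrow> leq V x z"
  using ord.le_trans[of x y z] by (simp add: order_of_def)

lemma leq_antisym:
  "\<lbrakk>leq V x y; leq V y x; x \<in> carrier V; y \<in> carrier V\<rbrakk> \<Longrightarrow> x = y"
  using ord.le_antisym[of x y] by (simp add: order_of_def)

lemma join_facts:
  assumes "x \<in> carrier V" "y \<in> carrier V"
  shows "x \<squnion>\<^bsub>order_of V\<^esub> y \<in> carrier V"
    and "leq V x (x \<squnion>\<^bsub>order_of V\<^esub> y)" and "leq V y (x \<squnion>\<^bsub>order_of V\<^esub> y)"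
    and "\<lbrakk>z \<in> carrier V; leq V x z; leq V y z\<rbrakk> \<Longrightarrow> leq V (x \<squnion>\<^bsub>order_of V\<^esub> y) z"
  using assms ord.join_closed[of x y] ord.join_left[of x y] ord.join_right[of x y]
    ord.join_le[of x z y]
  by (simp_all add: order_of_def)

lemma minus_nonpos:
  assumes "x \<in> carrier V" "leq V \<zero>\<^bsub>V\<^esub> x"
  shows "leq V (\<ominus>\<^bsub>V\<^esub> x) \<zero>\<^bsub>V\<^esub>"
  using add_mono[of "\<zero>\<^bsub>V\<^esub>" x "\<ominus>\<^bsub>V\<^esub> x"] assms by (simp add: M.r_neg)

lemma minus_nonneg:
  assumes "x \<in> carrier V" "leq V x \<zero>\<^bsub>V\<^esub>"
  shows "leq V \<zero>\<^bsub>V\<^esub> (\<ominus>\<^bsub>V\<^esub> x)"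
  using add_mono[of x "\<zero>\<^bsub>V\<^esub>" "\<ominus>\<^bsub>V\<^esub> x"] assms by (simp add: M.r_neg)

lemma absolute_value_nonneg:
  assumes "x \<in> carrier V" "leq V \<zero>\<^bsub>V\<^esub> x"
  shows "absolute_value V x = x"
proof -
  have m: "\<ominus>\<^bsub>V\<^esub> x \<in> carrier V" using assms by simp
  have "leq V (\<ominus>\<^bsub>V\<^esub> x) x"
    using leq_trans[OF minus_nonpos[OF assms] assms(2)] assms m by simp
  then show ?thesis
    unfolding absolute_value_def
    using join_facts[OF assms(1) m] assms leq_refl leq_antisym by blast
qed

lemma smult_nonneg:
  assumes "x \<in> carrier V" "leq V \<zero>\<^bsub>V\<^esub> x" "0 \<le> a"
  shows "leq V \<zero>\<^bsub>V\<^esub> (a \<odot>\<^bsub>V\<^esub> x)"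
  using smult_mono[of "\<zero>\<^bsub>V\<^esub>" x a] assms by simp

lemma smult_mono_scalar:
  assumes "x \<in> carrier V" "leq V \<zero>\<^bsub>V\<^esub> x" "a \<le> b"
  shows "leq V (a \<odot>\<^bsub>V\<^esub> x) (b \<odot>\<^bsub>V\<^esub> x)"
proof -
  have "b \<odot>\<^bsub>V\<^esub> x = ((b - a) \<odot>\<^bsub>V\<^esub> x) \<oplus>\<^bsub>V\<^esub> (a \<odot>\<^bsub>V\<^esub> x)"
    using smult_l_distr[of "b - a" a x] assms by simp
  then show ?thesis
    using add_mono[of "\<zero>\<^bsub>V\<^esub>" "(b - a) \<odot>\<^bsub>V\<^esub> x" "a \<odot>\<^bsub>V\<^esub> x"] smult_nonneg[of x "b - a"] assms
    by simp
qed

end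

context quasi_normed_lattice
begin

lemma qnorm_smult: "x \<in> carrier V \<Longrightarrow> qnorm V (a \<odot>\<^bsub>V\<^esub> x) = \<bar>a\<bar> * qnorm V x"
  and qnorm_eq_0_iff: "x \<in> carrier V \<Longrightarrow> qnorm V x = 0 \<longleftrightarrow> x = \<zero>\<^bsub>V\<^esub>"
  using quasi_norm unfolding quasi_norm_def by auto

lemma qnorm_zero: "qnorm V \<zero>\<^bsub>V\<^esub> = 0"
  using qnorm_eq_0_iff by simp

lemma qnorm_mono_nonneg:
  assumes "x \<in> carrier V" "y \<in> carrier V" "leq V \<zero>\<^bsub>V\<^esub> x" "leq V x y"
  shows "qnorm V x \<le> qnorm V y"
proof (rule qnorm_mono[OF assms(1,2)])
  have "leq V \<zero>\<^bsub>V\<^esub> y"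
    using leq_trans[OF assms(3,4)] assms by simp
  then show "leq V (absolute_value V x) (absolute_value V y)"
    using assms by (simp add: absolute_value_nonneg)
qed

text \<open>The concavity inequality for \<open>x\<close> and \<open>-x\<close> bounds \<open>0\<close> by a positive multiple of the
  quasi-norm of \<open>x\<close>.\<close>

lemma qnorm_nonneg:
  assumes x: "x \<in> carrier V"
  shows "0 \<le> qnorm V x"
proof -
  obtain C where C: "concavity_constant V C"
    using quasi_norm unfolding quasi_norm_def by blast
  have "x \<oplus>\<^bsub>V\<^esub> ((- 1) \<odot>\<^bsub>V\<^esub> x) = (1 + - 1) \<odot>\<^bsub>V\<^esub> x"
    using smult_l_distr[of 1 "- 1" x] smult_one[of x] x by simp
  also have "\<dots> = \<zero>\<^bsub>V\<^esub>"
    using smult_l_null[OF x] by simp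
  finally have "qnorm V (x \<oplus>\<^bsub>V\<^esub> ((- 1) \<odot>\<^bsub>V\<^esub> x)) = 0"
    by (simp add: qnorm_zero)
  moreover have "qnorm V (x \<oplus>\<^bsub>V\<^esub> ((- 1) \<odot>\<^bsub>V\<^esub> x)) \<le> C * (qnorm V x + qnorm V ((- 1) \<odot>\<^bsub>V\<^esub> x))"
    using C x unfolding concavity_constant_def by simp
  ultimately have "0 \<le> C * (2 * qnorm V x)"
    using qnorm_smult[OF x, of "- 1"] by simp
  moreover have "0 < C"
    using C unfolding concavity_constant_def by simp
  ultimately show ?thesis
    by (simp add: zero_le_mult_iff)
qed

text \<open>If the positive part of \<open>x \<noteq> 0\<close> vanishes, then \<open>-x\<close> is positive; so a nonzero positive
  element exists, and it can be normalised.\<close>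

lemma obtain_positive_unit:
  assumes "carrier V \<noteq> {\<zero>\<^bsub>V\<^esub>}"
  obtains y where "y \<in> carrier V" "leq V \<zero>\<^bsub>V\<^esub> y" "qnorm V y = 1"
proof -
  obtain x where x: "x \<in> carrier V" "x \<noteq> \<zero>\<^bsub>V\<^esub>"
    using assms M.zero_closed by blast
  define p where "p = x \<squnion>\<^bsub>order_of V\<^esub> \<zero>\<^bsub>V\<^esub>"
  have p: "p \<in> carrier V" "leq V x p" "leq V \<zero>\<^bsub>V\<^esub> p"
    using join_facts[OF x(1) M.zero_closed] unfolding p_def by simp_all
  obtain z where z: "z \<in> carrier V" "leq V \<zero>\<^bsub>V\<^esub> z" "z \<noteq> \<zero>\<^bsub>V\<^esub>"
  proof (cases "p = \<zero>\<^bsub>V\<^esub>")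
    case True
    have "\<ominus>\<^bsub>V\<^esub> x \<noteq> \<zero>\<^bsub>V\<^esub>"
      using x M.add.inv_eq_1_iff[OF x(1)] by (simp add: a_inv_def)
    then show thesis
      using that[of "\<ominus>\<^bsub>V\<^esub> x"] minus_nonneg[OF x(1)] p x True by simp
  qed (use p that in blast)
  have "qnorm V z > 0"
    using qnorm_nonneg[OF z(1)] qnorm_eq_0_iff[OF z(1)] z(3) by linarith
  then show thesis
    using that[of "(1 / qnorm V z) \<odot>\<^bsub>V\<^esub> z"] z smult_nonneg[of z "1 / qnorm V z"]
    by (simp add: qnorm_smult)
qed

lemma decreases_to_zero_qnorm_decseq:
  assumes "decreases_to_zero V f"
  shows "decseq (\<lambda>n. qnorm V (f n))"
  using assms unfolding decreases_to_zero_def by (intro decseq_SucI qnorm_mono_nonneg) auto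

text \<open>A lower bound \<open>l\<close> of the multiples \<open>a\<^sub>n y\<close> satisfies \<open>0 \<le> l\<^sup>+ \<le> a\<^sub>n y\<close>, so monotonicity of the
  quasi-norm forces \<open>l\<^sup>+ = 0\<close>: a quasi-normed lattice is Archimedean.\<close>

lemma decreases_to_zero_smult:
  assumes y: "y \<in> carrier V" "leq V \<zero>\<^bsub>V\<^esub> y"
    and a: "decseq a" "a \<longlonglongrightarrow> 0"
  shows "decreases_to_zero V (\<lambda>n. a n \<odot>\<^bsub>V\<^esub> y)"
proof -
  have a0: "0 \<le> a n" for n
    using decseq_ge[OF a] by simp
  have "leq V l \<zero>\<^bsub>V\<^esub>" if l: "l \<in> carrier V" "\<forall>n. leq V l (a n \<odot>\<^bsub>V\<^esub> y)" for l
  proof -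
    define p where "p = l \<squnion>\<^bsub>order_of V\<^esub> \<zero>\<^bsub>V\<^esub>"
    note j = join_facts[OF l(1) M.zero_closed, folded p_def]
    have "qnorm V p \<le> a n * qnorm V y" for n
    proof -
      have "leq V p (a n \<odot>\<^bsub>V\<^esub> y)"
        using j(4) l y a0 smult_nonneg by simp
      then have "qnorm V p \<le> qnorm V (a n \<odot>\<^bsub>V\<^esub> y)"
        using j y by (intro qnorm_mono_nonneg) auto
      then show ?thesis
        using qnorm_smult[OF y(1)] a0[of n] by simp
    qed
    moreover have "(\<lambda>n. a n * qnorm V y) \<longlonglongrightarrow> 0"
      using tendsto_mult_left_zero[OF a(2)] .
    ultimately have "qnorm V p \<le> 0"
      using LIMSEQ_le_const[of "\<lambda>n. a n * qnorm V y" 0 "qnorm V p"] by simp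
    then have "p = \<zero>\<^bsub>V\<^esub>"
      using qnorm_nonneg[of p] qnorm_eq_0_iff[of p] j(1) by simp
    then show ?thesis
      using j(2) by simp
  qed
  moreover have "leq V (a (Suc n) \<odot>\<^bsub>V\<^esub> y) (a n \<odot>\<^bsub>V\<^esub> y)" for n
    using smult_mono_scalar[OF y decseq_SucD[OF a(1)]] .
  moreover have "leq V \<zero>\<^bsub>V\<^esub> (a n \<odot>\<^bsub>V\<^esub> y)" for n
    using smult_nonneg[OF y a0] .
  moreover have "a n \<odot>\<^bsub>V\<^esub> y \<in> carrier V" for n
    using y(1) by simp
  ultimately show ?thesis
    unfolding decreases_to_zero_def by simp
qed

end

section \<open>Ideal spaces over a counting measure\<close>

abbreviation cls :: "'i set \<Rightarrow> ('i \<Rightarrow> real) \<Rightarrow> ('i \<Rightarrow> real) set"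
  where "cls I \<equiv> ae_class (count_space I)"

lemma cls_eq: "cls I f = {g. \<forall>\<alpha>\<in>I. g \<alpha> = f \<alpha>}"
  by (auto simp: ae_class_def AE_count_space)

lemma cls_eq_iff: "cls I f = cls I g \<longleftrightarrow> (\<forall>\<alpha>\<in>I. f \<alpha> = g \<alpha>)"
  unfolding cls_eq by (auto simp: set_eq_iff)

lemma L0_leq_iff: "leq (L0 (count_space I)) (cls I f) (cls I g) \<longleftrightarrow> (\<forall>\<alpha>\<in>I. f \<alpha> \<le> g \<alpha>)"
  unfolding L0_def cls_eq by (auto simp: AE_count_space)

lemma L0_smult: "a \<odot>\<^bsub>L0 (count_space I)\<^esub> cls I f = cls I (\<lambda>\<alpha>. a * f \<alpha>)"
  unfolding L0_def cls_eq by auto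

locale counting_ideal_space =
  fixes I :: "'i set" and E :: "('i \<Rightarrow> real) set set" and N :: "('i \<Rightarrow> real) set \<Rightarrow> real"
  assumes ideal_space: "quasi_normed_ideal_space (count_space I) E N"
begin

abbreviation "L \<equiv> ideal_lattice (count_space I) E N"

lemma cls_cases:
  assumes "F \<in> E" obtains f where "F = cls I f"
proof -
  have "submodule E real_field (L0 (count_space I))"
    using ideal_space unfolding quasi_normed_ideal_space_def by simp
  then have "E \<subseteq> carrier (L0 (count_space I))"
    using subgroup.subset[OF submodule.axioms(1)] by simp
  then have "F \<in> ae_class (count_space I) ` borel_measurable (count_space I)"
    using assms by (auto simp: L0_def)
  then show thesis
    by (rule imageE) (rule that)
qed

lemma smult_mem:
  assumes "cls I f \<in> E" shows "cls I (\<lambda>\<alpha>. a * f \<alpha>) \<in> E"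
proof -
  have "submodule E real_field (L0 (count_space I))"
    using ideal_space unfolding quasi_normed_ideal_space_def by blast
  then have "a \<odot>\<^bsub>L0 (count_space I)\<^esub> cls I f \<in> E"
    by (rule submodule.smult_closed) (use assms in simp_all)
  then show ?thesis
    unfolding L0_smult .
qed

lemma quasi_norm_L: "quasi_norm L"
  using ideal_space unfolding quasi_normed_ideal_space_def by blast

lemma N_smult:
  assumes "cls I f \<in> E" shows "N (cls I (\<lambda>\<alpha>. a * f \<alpha>)) = \<bar>a\<bar> * N (cls I f)"
proof -
  have "\<forall>F\<in>carrier L. qnorm L (a \<odot>\<^bsub>L\<^esub> F) = \<bar>a\<bar> * qnorm L F"
    using quasi_norm_L unfolding quasi_norm_def by blast
  then show ?thesis
    using assms by (simp add: ideal_lattice_def L0_smult[symmetric])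
qed

lemma N_eq_0_iff:
  assumes "cls I f \<in> E" shows "N (cls I f) = 0 \<longleftrightarrow> (\<forall>\<alpha>\<in>I. f \<alpha> = 0)"
proof -
  have "\<forall>F\<in>carrier L. qnorm L F = 0 \<longleftrightarrow> F = \<zero>\<^bsub>L\<^esub>"
    using quasi_norm_L unfolding quasi_norm_def by blast
  then show ?thesis
    using assms by (simp add: ideal_lattice_def L0_def cls_eq_iff)
qed

lemma solid:
  assumes "cls I g \<in> E" "\<And>\<alpha>. \<alpha> \<in> I \<Longrightarrow> \<bar>f \<alpha>\<bar> \<le> \<bar>g \<alpha>\<bar>"
  shows "cls I f \<in> E"
proof -
  have "\<forall>f\<in>borel_measurable (count_space I). \<forall>g\<in>borel_measurable (count_space I).
      cls I g \<in> E \<and> (AE \<alpha> in count_space I. \<bar>f \<alpha>\<bar> \<le> \<bar>g \<alpha>\<bar>) \<longrightarrow> cls I f \<in> E \<and> N (cls I f) \<le> N (cls I g)"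
    using ideal_space unfolding quasi_normed_ideal_space_def by blast
  then have "cls I g \<in> E \<and> (AE \<alpha> in count_space I. \<bar>f \<alpha>\<bar> \<le> \<bar>g \<alpha>\<bar>) \<longrightarrow> cls I f \<in> E"
    by simp
  then show ?thesis
    using assms by (simp add: AE_count_space)
qed

lemma obtain_positive:
  obtains w where "cls I w \<in> E" "\<And>\<alpha>. \<alpha> \<in> I \<Longrightarrow> 0 < w \<alpha>"
proof -
  have "\<exists>f\<in>borel_measurable (count_space I). cls I f \<in> E \<and> (\<forall>\<alpha>\<in>space (count_space I). 0 < f \<alpha>)"
    using ideal_space unfolding quasi_normed_ideal_space_def by blast
  then show thesis
    using that by auto
qed

text \<open>A strictly positive member of \<open>E\<close>, rescaled, dominates the indicator of any point.\<close>

lemma single_mem: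
  assumes \<alpha>: "\<alpha> \<in> I"
  shows "cls I (\<lambda>\<beta>. if \<beta> = \<alpha> then c else 0) \<in> E"
proof -
  obtain w where w: "cls I w \<in> E" "\<And>\<beta>. \<beta> \<in> I \<Longrightarrow> 0 < w \<beta>"
    using obtain_positive by blast
  show ?thesis
    using w(2)[OF \<alpha>] by (intro solid[OF smult_mem[OF w(1), of "c / w \<alpha>"]]) (auto simp: abs_mult)
qed

lemma zero_mem: "cls I (\<lambda>_. 0) \<in> E"
proof -
  obtain w where "cls I w \<in> E"
    using obtain_positive .
  then show ?thesis
    by (rule solid) simp
qed

text \<open>Order convergence in \<open>E\<close> is coordinatewise because the ideal contains the one-point
  functions: a positive limit \<open>c\<close> at \<open>\<alpha>\<close> would make \<open>c\<close> times the indicator of \<open>\<alpha>\<close> a lower bound.\<close>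

lemma decreases_to_zero_iff:
  "decreases_to_zero L (\<lambda>n. cls I (f n)) \<longleftrightarrow>
    (\<forall>n. cls I (f n) \<in> E) \<and> (\<forall>\<alpha>\<in>I. decseq (\<lambda>n. f n \<alpha>) \<and> (\<lambda>n. f n \<alpha>) \<longlonglongrightarrow> 0)"
    (is "?D \<longleftrightarrow> ?R")
proof -
  have D: "?D \<longleftrightarrow> (\<forall>n. cls I (f n) \<in> E) \<and> (\<forall>n. \<forall>\<alpha>\<in>I. f (Suc n) \<alpha> \<le> f n \<alpha>) \<and>
      (\<forall>n. \<forall>\<alpha>\<in>I. 0 \<le> f n \<alpha>) \<and>
      (\<forall>l. cls I l \<in> E \<longrightarrow> (\<forall>n. \<forall>\<alpha>\<in>I. l \<alpha> \<le> f n \<alpha>) \<longrightarrow> (\<forall>\<alpha>\<in>I. l \<alpha> \<le> 0))"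
  proof -
    have zero: "\<zero>\<^bsub>L\<^esub> = cls I (\<lambda>_. 0)" and car: "carrier L = E"
      and le: "leq L = leq (L0 (count_space I))"
      by (simp_all add: ideal_lattice_def L0_def)
    have ball: "(\<forall>F\<in>E. P F) \<longleftrightarrow> (\<forall>l. cls I l \<in> E \<longrightarrow> P (cls I l))" for P
      using cls_cases by blast
    show ?thesis
      unfolding decreases_to_zero_def zero car le L0_leq_iff ball
      using zero_mem by simp
  qed
  show ?thesis
  proof
    assume ?D
    then have E: "\<And>n. cls I (f n) \<in> E" and dec: "\<And>n \<alpha>. \<alpha> \<in> I \<Longrightarrow> f (Suc n) \<alpha> \<le> f n \<alpha>"
      and pos: "\<And>n \<alpha>. \<alpha> \<in> I \<Longrightarrow> 0 \<le> f n \<alpha>"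
      and inf: "\<And>l \<alpha>. \<lbrakk>cls I l \<in> E; \<And>n \<alpha>. \<alpha> \<in> I \<Longrightarrow> l \<alpha> \<le> f n \<alpha>; \<alpha> \<in> I\<rbrakk> \<Longrightarrow> l \<alpha> \<le> 0"
      unfolding D by blast+
    show ?R
    proof (intro conjI allI ballI)
      fix \<alpha> assume \<alpha>: "\<alpha> \<in> I"
      show ds: "decseq (\<lambda>n. f n \<alpha>)"
        using dec[OF \<alpha>] by (rule decseq_SucI)
      obtain c where c: "(\<lambda>n. f n \<alpha>) \<longlonglongrightarrow> c"
        using decseq_convergent[OF ds] pos[OF \<alpha>] by metis
      have "c \<le> f n \<alpha>" for n
        using decseq_ge[OF ds c] .
      then have "(\<lambda>\<beta>. if \<beta> = \<alpha> then c else 0) \<alpha> \<le> 0"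
        using pos \<alpha> by (intro inf[OF single_mem[OF \<alpha>]]) auto
      moreover have "0 \<le> c"
        using LIMSEQ_le_const[OF c] pos[OF \<alpha>] by blast
      ultimately show "(\<lambda>n. f n \<alpha>) \<longlonglongrightarrow> 0"
        using c by simp
    qed (rule E)
  next
    assume R: ?R
    have "0 \<le> f n \<alpha>" if "\<alpha> \<in> I" for n \<alpha>
      using R that decseq_ge[of "\<lambda>n. f n \<alpha>" 0 n] by blast
    moreover have "l \<alpha> \<le> 0" if "\<forall>n. \<forall>\<alpha>\<in>I. l \<alpha> \<le> f n \<alpha>" "\<alpha> \<in> I" for l \<alpha>
      using R that LIMSEQ_le_const[of "\<lambda>n. f n \<alpha>" 0 "l \<alpha>"] by blast
    ultimately show ?D
      unfolding D using R by (auto dest: decseq_SucD)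
  qed
qed

end

section \<open>Direct sums\<close>

locale lattice_family = counting_ideal_space I E N
  for I :: "'i set" and E N +
  fixes \<X> :: "'i \<Rightarrow> 'a quasi_normed_vs"
  assumes lattice: "\<alpha> \<in> I \<Longrightarrow> quasi_normed_lattice (\<X> \<alpha>)"
begin

abbreviation "S \<equiv> direct_sum I E N \<X>"

definition single :: "'i \<Rightarrow> 'a \<Rightarrow> 'i \<Rightarrow> 'a"
  where "single \<alpha> x = (\<lambda>\<beta>\<in>I. if \<beta> = \<alpha> then x else \<zero>\<^bsub>\<X> \<beta>\<^esub>)"

lemma zero_carrier: "\<alpha> \<in> I \<Longrightarrow> \<zero>\<^bsub>\<X> \<alpha>\<^esub> \<in> carrier (\<X> \<alpha>)"
proof -
  assume "\<alpha> \<in> I"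
  then interpret quasi_normed_lattice "\<X> \<alpha>" by (rule lattice)
  show ?thesis by simp
qed

lemma norm_class_single:
  "norm_class I \<X> (single \<alpha> x) = cls I (\<lambda>\<beta>. if \<beta> = \<alpha> then qnorm (\<X> \<alpha>) x else 0)"
  unfolding norm_class_def cls_eq_iff single_def
  by (auto simp: quasi_normed_lattice.qnorm_zero[OF lattice])

lemma single_carrier: "\<lbrakk>\<alpha> \<in> I; x \<in> carrier (\<X> \<alpha>)\<rbrakk> \<Longrightarrow> single \<alpha> x \<in> carrier S"
  using single_mem[of \<alpha> "qnorm (\<X> \<alpha>) x"] zero_carrier
  by (auto simp: direct_sum_def norm_class_single) (auto simp: single_def)

lemma zero_carrier_sum: "\<zero>\<^bsub>S\<^esub> \<in> carrier S"
proof -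
  have "norm_class I \<X> (\<lambda>\<alpha>\<in>I. \<zero>\<^bsub>\<X> \<alpha>\<^esub>) = cls I (\<lambda>_. 0)"
    unfolding norm_class_def cls_eq_iff
    by (auto simp: quasi_normed_lattice.qnorm_zero[OF lattice])
  then show ?thesis
    using zero_mem zero_carrier by (auto simp: direct_sum_def)
qed

text \<open>A lower bound in one summand extends by zero to a lower bound in the direct sum, so the
  infimum of a sequence of positive elements is zero exactly when it is zero in each
  coordinate.\<close>

lemma sum_decreases_to_zero_iff:
  "decreases_to_zero S f \<longleftrightarrow>
    (\<forall>n. f n \<in> carrier S) \<and> (\<forall>\<alpha>\<in>I. decreases_to_zero (\<X> \<alpha>) (\<lambda>n. f n \<alpha>))"
    (is "?D \<longleftrightarrow> ?R")
proof
  have le: "leq S g h \<longleftrightarrow> (\<forall>\<alpha>\<in>I. leq (\<X> \<alpha>) (g \<alpha>) (h \<alpha>))" for g h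
    by (simp add: direct_sum_def)
  have zero: "\<zero>\<^bsub>S\<^esub> = (\<lambda>\<alpha>\<in>I. \<zero>\<^bsub>\<X> \<alpha>\<^esub>)"
    by (simp add: direct_sum_def)
  have coord: "g \<alpha> \<in> carrier (\<X> \<alpha>)" if "g \<in> carrier S" "\<alpha> \<in> I" for g \<alpha>
    using that by (auto simp: direct_sum_def)
  {
    assume D: ?D
    have pos: "leq (\<X> \<beta>) \<zero>\<^bsub>\<X> \<beta>\<^esub> (f n \<beta>)" if "\<beta> \<in> I" for n \<beta>
      using D that unfolding decreases_to_zero_def le zero by auto
    have "leq (\<X> \<alpha>) l \<zero>\<^bsub>\<X> \<alpha>\<^esub>"
      if \<alpha>: "\<alpha> \<in> I" and l: "l \<in> carrier (\<X> \<alpha>)" "\<forall>n. leq (\<X> \<alpha>) l (f n \<alpha>)" for \<alpha> l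
    proof -
      have "leq S (single \<alpha> l) (f n)" for n
        unfolding le single_def using l pos by auto
      then have "leq S (single \<alpha> l) \<zero>\<^bsub>S\<^esub>"
        using D single_carrier[OF \<alpha> l(1)] unfolding decreases_to_zero_def by blast
      then show ?thesis
        unfolding le zero single_def using \<alpha> by auto
    qed
    then show ?R
      using D pos coord zero_carrier unfolding decreases_to_zero_def le by auto
  }
  {
    assume ?R
    then show ?D
      using zero_carrier_sum coord unfolding decreases_to_zero_def le zero by simp
  }
qed

text \<open>A summand sits in the direct sum as the families supported at one point, with its quasi-norm
  multiplied by the nonzero quasi-norm of the indicator of that point.\<close>

lemma order_continuous_summand:
  assumes oc: "order_continuous S" and \<alpha>: "\<alpha> \<in> I"
  shows "order_continuous (\<X> \<alpha>)"
  unfolding order_continuous_iff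
proof (intro allI impI)
  fix f assume f: "decreases_to_zero (\<X> \<alpha>) f"
  define e where "e = cls I (\<lambda>\<beta>. if \<beta> = \<alpha> then 1 else 0)"
  have e: "e \<in> E" "N e \<noteq> 0"
    using single_mem[OF \<alpha>, of 1] N_eq_0_iff[of "\<lambda>\<beta>. if \<beta> = \<alpha> then 1 else 0"] \<alpha>
    unfolding e_def by auto
  have zero: "decreases_to_zero (\<X> \<beta>) (\<lambda>n. \<zero>\<^bsub>\<X> \<beta>\<^esub>)" if "\<beta> \<in> I" for \<beta>
  proof -
    interpret quasi_normed_lattice "\<X> \<beta>" using that by (rule lattice)
    show ?thesis unfolding decreases_to_zero_def using leq_refl by auto
  qed
  have "decreases_to_zero (\<X> \<beta>) (\<lambda>n. single \<alpha> (f n) \<beta>)" if "\<beta> \<in> I" for \<beta>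
    using that f zero[OF that] by (cases "\<beta> = \<alpha>") (simp_all add: single_def)
  then have "decreases_to_zero S (\<lambda>n. single \<alpha> (f n))"
    using f single_carrier[OF \<alpha>]
    unfolding sum_decreases_to_zero_iff by (auto simp: decreases_to_zero_def)
  then have "(\<lambda>n. qnorm S (single \<alpha> (f n))) \<longlonglongrightarrow> 0"
    using oc unfolding order_continuous_iff by blast
  moreover have "qnorm S (single \<alpha> (f n)) = \<bar>qnorm (\<X> \<alpha>) (f n)\<bar> * N e" for n
  proof -
    have "(\<lambda>\<beta>. if \<beta> = \<alpha> then qnorm (\<X> \<alpha>) (f n) else 0) =
        (\<lambda>\<beta>. qnorm (\<X> \<alpha>) (f n) * (if \<beta> = \<alpha> then 1 else 0))"
      by auto
    then show ?thesis
      using N_smult[OF e(1)[unfolded e_def], of "qnorm (\<X> \<alpha>) (f n)"]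
      by (simp add: direct_sum_def norm_class_single e_def)
  qed
  ultimately have "(\<lambda>n. \<bar>qnorm (\<X> \<alpha>) (f n)\<bar> * N e / N e) \<longlonglongrightarrow> 0"
    using tendsto_divide_zero by fastforce
  then show "(\<lambda>n. qnorm (\<X> \<alpha>) (f n)) \<longlonglongrightarrow> 0"
    using e(2) by (simp add: tendsto_rabs_zero_iff)
qed

text \<open>With positive unit vectors \<open>y\<^sub>\<alpha>\<close>, the map sending \<open>u\<close> to \<open>(u\<^sub>\<alpha> y\<^sub>\<alpha>)\<^sub>\<alpha>\<close> embeds the positive
  cone of \<open>E\<close> in the direct sum isometrically.\<close>

lemma order_continuous_index_space:
  assumes oc: "order_continuous S"
    and nontrivial: "\<And>\<alpha>. \<alpha> \<in> I \<Longrightarrow> carrier (\<X> \<alpha>) \<noteq> {\<zero>\<^bsub>\<X> \<alpha>\<^esub>}"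
  shows "order_continuous L"
  unfolding order_continuous_iff
proof (intro allI impI)
  fix F assume F: "decreases_to_zero L F"
  then have "\<forall>n. F n \<in> E"
    unfolding decreases_to_zero_def by (simp add: ideal_lattice_def)
  then have "\<forall>n. \<exists>u. F n = cls I u"
    using cls_cases by metis
  then obtain u where u: "F = (\<lambda>n. cls I (u n))"
    by metis
  have uE: "cls I (u n) \<in> E"
    and dec: "\<alpha> \<in> I \<Longrightarrow> decseq (\<lambda>n. u n \<alpha>)" and lim: "\<alpha> \<in> I \<Longrightarrow> (\<lambda>n. u n \<alpha>) \<longlonglongrightarrow> 0" for n \<alpha>
    using F unfolding u decreases_to_zero_iff by blast+
  have u0: "0 \<le> u n \<alpha>" if "\<alpha> \<in> I" for n \<alpha>
    using decseq_ge[OF dec lim] that by blast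
  have "\<forall>\<alpha>\<in>I. \<exists>y. y \<in> carrier (\<X> \<alpha>) \<and> leq (\<X> \<alpha>) \<zero>\<^bsub>\<X> \<alpha>\<^esub> y \<and> qnorm (\<X> \<alpha>) y = 1"
    using quasi_normed_lattice.obtain_positive_unit[OF lattice nontrivial] by metis
  then obtain y where y: "\<And>\<alpha>. \<alpha> \<in> I \<Longrightarrow> y \<alpha> \<in> carrier (\<X> \<alpha>)"
      "\<And>\<alpha>. \<alpha> \<in> I \<Longrightarrow> leq (\<X> \<alpha>) \<zero>\<^bsub>\<X> \<alpha>\<^esub> (y \<alpha>)" "\<And>\<alpha>. \<alpha> \<in> I \<Longrightarrow> qnorm (\<X> \<alpha>) (y \<alpha>) = 1"
    by metis
  define g where "g n = (\<lambda>\<alpha>\<in>I. u n \<alpha> \<odot>\<^bsub>\<X> \<alpha>\<^esub> y \<alpha>)" for n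
  have g: "decreases_to_zero (\<X> \<alpha>) (\<lambda>n. g n \<alpha>)" if "\<alpha> \<in> I" for \<alpha>
    using quasi_normed_lattice.decreases_to_zero_smult[OF lattice y(1,2) dec lim] that
    by (simp add: g_def)
  have nc: "norm_class I \<X> (g n) = cls I (u n)" for n
    unfolding norm_class_def cls_eq_iff
    by (auto simp: g_def quasi_normed_lattice.qnorm_smult[OF lattice] y u0)
  have "g n \<in> (\<Pi>\<^sub>E \<alpha>\<in>I. carrier (\<X> \<alpha>))" for n
    using g unfolding decreases_to_zero_def by (auto simp: g_def)
  then have "g n \<in> carrier S" for n
    using nc uE by (simp add: direct_sum_def)
  then have "(\<lambda>n. qnorm S (g n)) \<longlonglongrightarrow> 0"
    using oc g unfolding order_continuous_iff sum_decreases_to_zero_iff by blast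
  then show "(\<lambda>n. qnorm L (F n)) \<longlonglongrightarrow> 0"
    by (simp add: direct_sum_def nc ideal_lattice_def u)
qed

text \<open>Order continuity of the summands turns a sequence of families decreasing to zero into a sequence
  of coordinate norms decreasing to zero pointwise, to which order continuity of \<open>E\<close> applies.\<close>

lemma order_continuous_direct_sum:
  assumes E: "order_continuous L" and X: "\<And>\<alpha>. \<alpha> \<in> I \<Longrightarrow> order_continuous (\<X> \<alpha>)"
  shows "order_continuous S"
  unfolding order_continuous_iff
proof (intro allI impI)
  fix f assume f: "decreases_to_zero S f"
  define u where "u n \<alpha> = qnorm (\<X> \<alpha>) (f n \<alpha>)" for n \<alpha>
  have f\<alpha>: "decreases_to_zero (\<X> \<alpha>) (\<lambda>n. f n \<alpha>)" if "\<alpha> \<in> I" for \<alpha>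
    using f that unfolding sum_decreases_to_zero_iff by blast
  have nc: "norm_class I \<X> (f n) = cls I (u n)" for n
    by (simp add: norm_class_def cls_eq_iff u_def)
  have "cls I (u n) \<in> E" for n
    using f unfolding sum_decreases_to_zero_iff by (simp add: direct_sum_def flip: nc)
  moreover have "decseq (\<lambda>n. u n \<alpha>)" if "\<alpha> \<in> I" for \<alpha>
    using quasi_normed_lattice.decreases_to_zero_qnorm_decseq[OF lattice f\<alpha>] that
    by (simp add: u_def)
  moreover have "(\<lambda>n. u n \<alpha>) \<longlonglongrightarrow> 0" if "\<alpha> \<in> I" for \<alpha>
    using X[OF that] f\<alpha>[OF that] unfolding order_continuous_iff u_def by blast
  ultimately have "decreases_to_zero L (\<lambda>n. cls I (u n))"
    unfolding decreases_to_zero_iff by blast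
  then have "(\<lambda>n. qnorm L (cls I (u n))) \<longlonglongrightarrow> 0"
    using E unfolding order_continuous_iff by blast
  then show "(\<lambda>n. qnorm S (f n)) \<longlonglongrightarrow> 0"
    by (simp add: ideal_lattice_def direct_sum_def nc)
qed

end

theorem theorem3p2:
  fixes I :: "'i set"
    and E :: "('i \<Rightarrow> real) set set" and N :: "('i \<Rightarrow> real) set \<Rightarrow> real"
    and \<X> :: "'i \<Rightarrow> 'a quasi_normed_vs"
  assumes "countable I"
    and "quasi_normed_ideal_space (count_space I) E N"
    and "\<And>\<alpha>. \<alpha> \<in> I \<Longrightarrow> quasi_normed_lattice (\<X> \<alpha>)"
    and "\<And>\<alpha>. \<alpha> \<in> I \<Longrightarrow> carrier (\<X> \<alpha>) \<noteq> {\<zero>\<^bsub>\<X> \<alpha>\<^esub>}"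
    and "bdd_above ((\<lambda>\<alpha>. modulus_of_concavity (\<X> \<alpha>)) ` I)"
  shows "order_continuous (direct_sum I E N \<X>) \<longleftrightarrow>
    order_continuous (ideal_lattice (count_space I) E N) \<and> (\<forall>\<alpha>\<in>I. order_continuous (\<X> \<alpha>))"
proof -
  interpret lattice_family I E N \<X>
    using assms(2,3)
    by (intro lattice_family.intro counting_ideal_space.intro lattice_family_axioms.intro)
  show ?thesis
    using order_continuous_index_space order_continuous_summand order_continuous_direct_sum assms(4)
    by blast
qed

end
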